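(* Let $p=(12,R)$ be the mesh pattern with $R=\{(0,1),(0,2),(1,1),(1,2),(2,0)\}$. Let $F(x)=\sum_{n\ge0}n!\,x^n$, $F(x,q)=\sum_{n\ge 0}x^n\sum_{\pi\in S_n}q^{p(\pi)}$, and $A(x)=\sum_{n\ge0}|S_n(p)|x^n$. Then, as formal power series in $x$, $$A(x)=\frac{2F(x)-1}{F(x)},\qquad F(x,q)= \frac{(2-q)F(x)+q-1}{(1-q)F(x)+q}.$$
   Context: $S_n$ is the set of permutations $\pi=\pi_1\cdots\pi_n$ of $\{1,\dots,n\}$ ($S_0$ contains only the empty permutation). A mesh pattern $(12,R)$ consists of the permutation $12$ and a set $R\subseteq\{0,1,2\}\times\{0,1,2\}$ of shaded boxes. An occurrence of $(12,R)$ in $\pi\in S_n$ is a pair of positions $s<t$ with $\pi_s<\pi_t$ such that, putting $s_0=0,\ s_1=s,\ s_2=t,\ s_3=n+1$ and $v_0=0,\ v_1=\pi_s,\ v_2=\pi_t,\ v_3=n+1$, for every $(i,j)\in R$ there is no position $m$ with $s_i<m<s_{i+1}$ and $v_j<\pi_m<v_{j+1}$. $p(\pi)$ is the number of occurrences of $p$ in $\pi$, and $S_n(p)$ is the set of $\pi\in S_n$ with $p(\pi)=0$ (permutations avoiding $p$). *)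

theory Defs
  imports
    "HOL-Computational_Algebra.Formal_Power_Series"
    "HOL-Computational_Algebra.Polynomial"
    "HOL-Computational_Algebra.Fraction_Field"
    "HOL-Combinatorics.Permutations"
begin

text \<open>A permutation \<open>\<pi>\<^sub>1\<cdots>\<pi>\<^sub>n\<close> is a function on the naturals that permutes \<open>{1..n}\<close>, hence is the
  identity elsewhere; for \<open>n = 0\<close> only \<open>id\<close> remains.\<close>

definition Sn :: "nat \<Rightarrow> (nat \<Rightarrow> nat) set" where
  "Sn n = {\<pi>. \<pi> permutes {1..n}}"

text \<open>The mesh pattern \<open>(12, R)\<close> is given by its set \<open>R \<subseteq> {0,1,2} \<times> {0,1,2}\<close> of shaded boxes, where
  \<open>(i, j)\<close> is the box in column \<open>i\<close> and row \<open>j\<close>. The lists below are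
  \<open>s\<^sub>0, \<dots>, s\<^sub>3\<close> and \<open>v\<^sub>0, \<dots>, v\<^sub>3\<close>.\<close>

definition mesh12_occurrences :: "(nat \<times> nat) set \<Rightarrow> nat \<Rightarrow> (nat \<Rightarrow> nat) \<Rightarrow> (nat \<times> nat) set" where
  "mesh12_occurrences R n \<pi> =
    {(s, t). s \<in> {1..n} \<and> t \<in> {1..n} \<and> s < t \<and> \<pi> s < \<pi> t \<and>
      (\<forall>(i, j) \<in> R. \<not> (\<exists>m \<in> {1..n}.
         [0, s, t, n + 1] ! i < m \<and> m < [0, s, t, n + 1] ! (i + 1) \<and>
         [0, \<pi> s, \<pi> t, n + 1] ! j < \<pi> m \<and> \<pi> m < [0, \<pi> s, \<pi> t, n + 1] ! (j + 1)))}"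

definition mesh12_count :: "(nat \<times> nat) set \<Rightarrow> nat \<Rightarrow> (nat \<Rightarrow> nat) \<Rightarrow> nat" where
  "mesh12_count R n \<pi> = card (mesh12_occurrences R n \<pi>)"

definition Sn_avoiding :: "(nat \<times> nat) set \<Rightarrow> nat \<Rightarrow> (nat \<Rightarrow> nat) set" where
  "Sn_avoiding R n = {\<pi> \<in> Sn n. mesh12_count R n \<pi> = 0}"

definition perm_gf :: "'a::semiring_char_0 fps" where
  "perm_gf = Abs_fps (\<lambda>n. fact n)"

definition avoidance_gf :: "(nat \<times> nat) set \<Rightarrow> 'a::semiring_1 fps" where
  "avoidance_gf R = Abs_fps (\<lambda>n. of_nat (card (Sn_avoiding R n)))"

definition distribution_gf :: "(nat \<times> nat) set \<Rightarrow> 'a::comm_semiring_1 \<Rightarrow> 'a fps" where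
  "distribution_gf R q = Abs_fps (\<lambda>n. \<Sum>\<pi> \<in> Sn n. q ^ mesh12_count R n \<pi>)"

text \<open>The indeterminate \<open>q\<close>, as an element of the field \<open>\<rat>(q)\<close>, so that quotients of power series
  in \<open>x\<close> over \<open>\<int>[q] \<subseteq> \<rat>(q)\<close> can be written with the division of \<open>fps\<close>.\<close>

definition indet_q :: "rat poly fract" where
  "indet_q = Fract [:0, 1:] 1"

end

theory Submission
  imports Defs
begin

text \<open>
  The shaded boxes force an occurrence \<open>(s, t)\<close> to sit in a very rigid place. Everything to the
  left of \<open>t\<close> other than \<open>\<pi> s\<close> must be smaller than \<open>\<pi> s\<close>, and everything to the right of \<open>t\<close> must
  be larger than \<open>\<pi> s\<close>. Hence the first \<open>t - 1\<close> entries are exactly \<open>1, \<dots>, \<pi> s\<close>. So occurrences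
  correspond to the cuts of \<open>\<pi>\<close>, the \<open>k\<close> with \<open>0 < k < n\<close> such that \<open>\<pi>\<close> maps \<open>{1..k}\<close> onto itself:
  such a \<open>k\<close> determines \<open>t = k + 1\<close> and \<open>s = \<pi>\<^sup>-\<^sup>1 k\<close> (lemma \<open>mesh12_count_eq_card_cuts\<close>).
  A nonempty permutation is therefore counted by one less than its number of direct summands.

  The distribution of the number of cuts is found without enumerating indecomposable permutations.
  List the cuts of \<open>\<pi>\<close> in increasing order and weight each cut by \<open>q\<close> to the number of smaller cuts.
  The weights form the geometric sum \<open>1 + q + \<dots> + q\<^bsup>c - 1\<^esup>\<close>, where \<open>c\<close> is the number of cuts, and
  multiplication by \<open>1 - q\<close> gives \<open>1 - q\<^bsup>c\<^esup>\<close>. On the other hand, a permutation with a marked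
  cut \<open>k\<close> is a pair of an arbitrary permutation of \<open>{1..k}\<close>, whose own cuts are the smaller ones, and
  an arbitrary permutation of \<open>{k+1..n}\<close>. Summing over \<open>S\<^sub>n\<close> in both ways yields
  \<open>F - 1 - D = (1 - q) D (F - 1)\<close> for \<open>F = F(x)\<close> and \<open>D = F(x, q) - 1\<close>,
  which is the second formula after division. The number of avoiders is the number of
  permutations without cuts, so the first formula is the case \<open>q = 0\<close>.
\<close>

section \<open>Occurrences and cuts\<close>

definition cuts :: "nat \<Rightarrow> (nat \<Rightarrow> nat) \<Rightarrow> nat set" where
  "cuts n \<pi> = {k \<in> {1..<n}. \<pi> ` {1..k} = {1..k}}"

lemma finite_cuts [simp]: "finite (cuts n \<pi>)"
  unfolding cuts_def by simp

definition cut_mesh :: "(nat \<times> nat) set" where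
  "cut_mesh = {(0,1), (0,2), (1,1), (1,2), (2,0)}"

text \<open>The four boxes in columns 0 and 1 together say that every other entry before \<open>t\<close> lies below
  \<open>\<pi> s\<close>; the box \<open>(2,0)\<close> says that no entry after \<open>t\<close> does.\<close>

lemma cut_mesh_occurrence_iff:
  assumes "\<pi> permutes {1..n}"
  shows "(s, t) \<in> mesh12_occurrences cut_mesh n \<pi> \<longleftrightarrow>
    s \<in> {1..n} \<and> t \<in> {1..n} \<and> s < t \<and> \<pi> s < \<pi> t \<and>
    (\<forall>m \<in> {1..<t}. m \<noteq> s \<longrightarrow> \<pi> m < \<pi> s) \<and> (\<forall>m \<in> {t<..n}. \<pi> s < \<pi> m)"
    (is "?occ \<longleftrightarrow> ?ord")
proof -
  have pos: "0 < \<pi> m \<and> \<pi> m < n + 1" if "m \<in> {1..n}" for m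
    using permutes_in_image[OF assms, of m] that by auto
  have ne: "\<pi> m \<noteq> \<pi> l" if "m \<noteq> l" for m l
    using permutes_inj[OF assms] that by (auto dest: injD)
  have "?occ \<longleftrightarrow> s \<in> {1..n} \<and> t \<in> {1..n} \<and> s < t \<and> \<pi> s < \<pi> t \<and>
      \<not> (\<exists>m\<in>{1..n}. 0 < m \<and> m < s \<and> \<pi> s < \<pi> m \<and> \<pi> m < \<pi> t) \<and>
      \<not> (\<exists>m\<in>{1..n}. 0 < m \<and> m < s \<and> \<pi> t < \<pi> m \<and> \<pi> m < n + 1) \<and>
      \<not> (\<exists>m\<in>{1..n}. s < m \<and> m < t \<and> \<pi> s < \<pi> m \<and> \<pi> m < \<pi> t) \<and>
      \<not> (\<exists>m\<in>{1..n}. s < m \<and> m < t \<and> \<pi> t < \<pi> m \<and> \<pi> m < n + 1) \<and>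
      \<not> (\<exists>m\<in>{1..n}. t < m \<and> m < n + 1 \<and> 0 < \<pi> m \<and> \<pi> m < \<pi> s)"
    unfolding mesh12_occurrences_def cut_mesh_def mem_Collect_eq prod.case
    by (auto simp: numeral_2_eq_2)
  also have "\<dots> \<longleftrightarrow> ?ord"
  proof (rule iffI, goal_cases)
    case 1
    have "\<pi> m < \<pi> s" if "m \<in> {1..<t}" "m \<noteq> s" for m
    proof -
      have m: "m \<in> {1..n}" "m < t" "m \<noteq> t" using that 1 by auto
      consider "m < s" | "s < m" using \<open>m \<noteq> s\<close> by linarith
      then show ?thesis
        using 1 m pos[OF m(1)] ne[OF \<open>m \<noteq> s\<close>] ne[OF m(3)]
        by cases (metis atLeastAtMost_iff gr0I linorder_neqE_nat not_one_le_zero)+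
    qed
    moreover have "\<pi> s < \<pi> m" if "m \<in> {t<..n}" for m
    proof -
      have m: "m \<in> {1..n}" "t < m" "m < n + 1" "m \<noteq> s" using that 1 by auto
      then show ?thesis using 1 pos[OF m(1)] ne[OF m(4)] by (metis linorder_neqE_nat)
    qed
    ultimately show ?case using 1 by blast
  next
    case 2
    have "\<not> \<pi> s < \<pi> m \<and> \<not> \<pi> t < \<pi> m" if "m \<in> {1..n}" "m < t" for m
    proof (cases "m = s")
      case False
      then have "\<pi> m < \<pi> s" using 2 that by auto
      then show ?thesis using 2 by auto
    qed (use 2 in auto)
    moreover have "m < t" if "m < s" for m using 2 that by auto
    moreover have "\<not> \<pi> m < \<pi> s" if "m \<in> {1..n}" "t < m" for m
      using 2 that by (meson atLeastAtMost_iff greaterThanAtMost_iff less_asym)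
    ultimately show ?case using 2 by blast
  qed
  finally show ?thesis .
qed

text \<open>An occurrence \<open>(s, t)\<close> makes the values \<open>1, \<dots>, \<pi> s\<close> fill precisely the positions before \<open>t\<close>,
  and comparing sizes gives \<open>t = \<pi> s + 1\<close>, so \<open>\<pi> s\<close> is a cut. Conversely, after a cut \<open>k\<close> every
  entry exceeds \<open>k\<close>, so the maximum \<open>k\<close> of the first block and the first entry of the rest
  form an occurrence.\<close>

lemma cut_mesh_occurrences_eq:
  assumes \<pi>: "\<pi> permutes {1..n}"
  shows "mesh12_occurrences cut_mesh n \<pi> = (\<lambda>k. (inv \<pi> k, Suc k)) ` cuts n \<pi>"
proof (intro subset_antisym subsetI)
  fix x assume "x \<in> mesh12_occurrences cut_mesh n \<pi>"
  then obtain s t where x: "x = (s, t)" and st: "s \<in> {1..n}" "t \<in> {1..n}" "s < t" "\<pi> s < \<pi> t"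
    and before: "\<forall>m \<in> {1..<t}. m \<noteq> s \<longrightarrow> \<pi> m < \<pi> s"
    and after: "\<forall>m \<in> {t<..n}. \<pi> s < \<pi> m"
    using cut_mesh_occurrence_iff[OF \<pi>] by (cases x) blast
  have img: "\<pi> ` {1..<t} = {1..\<pi> s}"
  proof (intro subset_antisym subsetI)
    fix v assume "v \<in> \<pi> ` {1..<t}"
    then obtain m where m: "m \<in> {1..<t}" "v = \<pi> m" by blast
    have "\<pi> m \<in> {1..n}" using permutes_in_image[OF \<pi>, of m] m st by auto
    then show "v \<in> {1..\<pi> s}" using m before by (cases "m = s") auto
  next
    fix v assume v: "v \<in> {1..\<pi> s}"
    have "\<pi> s \<in> {1..n}" using permutes_in_image[OF \<pi>, of s] st by auto
    then have "v \<in> \<pi> ` {1..n}" using v permutes_image[OF \<pi>] by auto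
    then obtain m where m: "m \<in> {1..n}" "v = \<pi> m" by blast
    have "\<not> t < m" using after m v by (metis atLeastAtMost_iff greaterThanAtMost_iff not_le)
    moreover have "m \<noteq> t" using m v st by auto
    ultimately show "v \<in> \<pi> ` {1..<t}" using m by auto
  qed
  have "card (\<pi> ` {1..<t}) = t - 1"
    using card_image[OF permutes_inj_on[OF \<pi>]] by simp
  then have t: "t = Suc (\<pi> s)" using img st by simp
  have "\<pi> s \<in> cuts n \<pi>"
    using img st unfolding cuts_def t by (auto simp: atLeastLessThanSuc_atLeastAtMost)
  moreover have "inv \<pi> (\<pi> s) = s" using permutes_inverses(2)[OF \<pi>] .
  ultimately show "x \<in> (\<lambda>k. (inv \<pi> k, Suc k)) ` cuts n \<pi>"
    unfolding x t by (force intro!: image_eqI[of _ _ "\<pi> s"])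
next
  fix x assume "x \<in> (\<lambda>k. (inv \<pi> k, Suc k)) ` cuts n \<pi>"
  then obtain k where x: "x = (inv \<pi> k, Suc k)" and k: "k \<in> {1..<n}"
    and img: "\<pi> ` {1..k} = {1..k}"
    unfolding cuts_def by blast
  define s where "s = inv \<pi> k"
  have \<pi>s: "\<pi> s = k" unfolding s_def using permutes_inverses(1)[OF \<pi>] .
  have below: "\<pi> m \<in> {1..k} \<longleftrightarrow> m \<in> {1..k}" for m
    using img permutes_inj[OF \<pi>] by (metis inj_image_mem_iff)
  have s: "s \<in> {1..k}" using below[of s] k unfolding \<pi>s by auto
  have lt: "\<pi> m < k" if "m \<in> {1..k}" "m \<noteq> s" for m
    using below[of m] that \<pi>s permutes_inj[OF \<pi>] by (metis atLeastAtMost_iff injD le_neq_implies_less)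
  have gt: "k < \<pi> m" if "m \<in> {k<..n}" for m
    using below[of m] that permutes_in_image[OF \<pi>, of m] by auto
  show "x \<in> mesh12_occurrences cut_mesh n \<pi>"
    unfolding x s_def[symmetric] cut_mesh_occurrence_iff[OF \<pi>] \<pi>s
    using s k lt gt by auto
qed

lemma mesh12_count_eq_card_cuts:
  assumes "\<pi> permutes {1..n}"
  shows "mesh12_count cut_mesh n \<pi> = card (cuts n \<pi>)"
  unfolding mesh12_count_def cut_mesh_occurrences_eq[OF assms]
  by (intro card_image inj_onI) simp

section \<open>Permutations with a marked cut\<close>

text \<open>The elements of \<open>K\<close> in increasing order have \<open>0, 1, 2, \<dots>\<close> smaller elements.\<close>

lemma sum_power_card_below:
  fixes q :: "'a::comm_semiring_1" and K :: "'b::linorder set"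
  assumes "finite K"
  shows "(\<Sum>k\<in>K. q ^ card {j \<in> K. j < k}) = (\<Sum>i<card K. q ^ i)"
  using assms
proof (induction K rule: finite_linorder_max_induct)
  case empty
  then show ?case by simp
next
  case (insert b K)
  have "{j \<in> insert b K. j < b} = K" using insert by auto
  moreover have "{j \<in> insert b K. j < k} = {j \<in> K. j < k}" if "k \<in> K" for k
    using insert that by auto
  moreover have "b \<notin> K" using insert by auto
  ultimately show ?case using insert by (simp add: add.commute)
qed

text \<open>A permutation with cut \<open>k\<close> is the product of its restrictions to \<open>{1..k}\<close> and \<open>{k+1..n}\<close>.
  The first factor is the same function as \<open>\<pi>\<close> on \<open>{1..k}\<close>, so the cuts of \<open>\<pi>\<close> below \<open>k\<close> are
  its cuts.\<close>

lemma sum_power_cuts_below_marked_cut: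
  fixes q :: "'a::{comm_semiring_1, semiring_char_0}"
  assumes k: "k \<in> {1..<n}"
  shows "(\<Sum>\<pi> | \<pi> \<in> Sn n \<and> k \<in> cuts n \<pi>. q ^ card {j \<in> cuts n \<pi>. j < k})
       = (\<Sum>\<sigma>\<in>Sn k. q ^ card (cuts k \<sigma>)) * fact (n - k)"
proof -
  define T where "T = {\<tau>. \<tau> permutes {k<..n}}"
  have comp: "(\<sigma> \<circ> \<tau>) x = (if x \<in> {k<..n} then \<tau> x else \<sigma> x)"
    if "\<sigma> permutes {1..k}" "\<tau> permutes {k<..n}" for \<sigma> \<tau> x
    using permutes_in_image[OF that(2), of x] permutes_not_in[OF that(1), of "\<tau> x"]
      permutes_not_in[OF that(2), of x] by auto
  have "(\<Sum>\<pi> | \<pi> \<in> Sn n \<and> k \<in> cuts n \<pi>. q ^ card {j \<in> cuts n \<pi>. j < k})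
      = (\<Sum>(\<sigma>, \<tau>)\<in>Sn k \<times> T. q ^ card (cuts k \<sigma>))"
  proof (rule sum.reindex_bij_witness[where
        i = "\<lambda>(\<sigma>, \<tau>). \<sigma> \<circ> \<tau>" and j = "\<lambda>\<pi>. (restrict_id \<pi> {1..k}, restrict_id \<pi> {k<..n})"])
    fix \<pi> assume "\<pi> \<in> {\<pi>. \<pi> \<in> Sn n \<and> k \<in> cuts n \<pi>}"
    then have \<pi>: "\<pi> permutes {1..n}" and img: "\<pi> ` {1..k} = {1..k}"
      by (auto simp: Sn_def cuts_def)
    have split: "{k<..n} = {1..n} - {1..k}" using k by auto
    have img': "\<pi> ` {k<..n} = {k<..n}"
      unfolding split using img permutes_image[OF \<pi>]
      by (simp add: image_set_diff[OF permutes_inj[OF \<pi>]])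
    have res: "restrict_id \<pi> A permutes A" if "\<pi> ` A = A" for A
      using that permutes_inj_on[OF \<pi>]
      by (intro permutes_restrict_id) (simp add: bij_betw_def)
    show "(restrict_id \<pi> {1..k}, restrict_id \<pi> {k<..n}) \<in> Sn k \<times> T"
      using res[OF img] res[OF img'] by (simp add: Sn_def T_def)
    show "(case (restrict_id \<pi> {1..k}, restrict_id \<pi> {k<..n}) of (\<sigma>, \<tau>) \<Rightarrow> \<sigma> \<circ> \<tau>) = \<pi>"
    proof
      fix x
      show "(case (restrict_id \<pi> {1..k}, restrict_id \<pi> {k<..n}) of (\<sigma>, \<tau>) \<Rightarrow> \<sigma> \<circ> \<tau>) x = \<pi> x"
        unfolding prod.case comp[OF res[OF img] res[OF img']]
        using permutes_not_in[OF \<pi>, of x] by (auto simp: restrict_id_def)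
    qed
    have "{j \<in> cuts n \<pi>. j < k} = cuts k (restrict_id \<pi> {1..k})"
    proof -
      have "restrict_id \<pi> {1..k} ` {1..j} = \<pi> ` {1..j}" if "j < k" for j
        by (rule image_cong) (use that in \<open>auto simp: restrict_id_def\<close>)
      then show ?thesis using k by (auto simp: cuts_def)
    qed
    then show "(case (restrict_id \<pi> {1..k}, restrict_id \<pi> {k<..n}) of (\<sigma>, \<tau>) \<Rightarrow> q ^ card (cuts k \<sigma>))
        = q ^ card {j \<in> cuts n \<pi>. j < k}" by simp
  next
    fix x assume "x \<in> Sn k \<times> T"
    then obtain \<sigma> \<tau> where x: "x = (\<sigma>, \<tau>)"
      and \<sigma>: "\<sigma> permutes {1..k}" and \<tau>: "\<tau> permutes {k<..n}"
      by (auto simp: Sn_def T_def)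
    note c = comp[OF \<sigma> \<tau>]
    show "(restrict_id (case x of (\<sigma>, \<tau>) \<Rightarrow> \<sigma> \<circ> \<tau>) {1..k},
        restrict_id (case x of (\<sigma>, \<tau>) \<Rightarrow> \<sigma> \<circ> \<tau>) {k<..n}) = x"
      unfolding x prod.case restrict_id_def c
      using permutes_not_in[OF \<sigma>] permutes_not_in[OF \<tau>] by (auto simp: fun_eq_iff)
    have "\<sigma> \<circ> \<tau> permutes {1..n}"
      by (intro permutes_compose permutes_subset[OF \<sigma>] permutes_subset[OF \<tau>])
        (use k in auto)
    moreover have "(\<sigma> \<circ> \<tau>) ` {1..k} = \<sigma> ` {1..k}"
      by (rule image_cong) (auto simp: c simp del: comp_apply)
    ultimately show "(case x of (\<sigma>, \<tau>) \<Rightarrow> \<sigma> \<circ> \<tau>) \<in> {\<pi>. \<pi> \<in> Sn n \<and> k \<in> cuts n \<pi>}"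
      using k permutes_image[OF \<sigma>] by (simp add: x Sn_def cuts_def)
  qed
  also have "\<dots> = (\<Sum>\<sigma>\<in>Sn k. q ^ card (cuts k \<sigma>)) * of_nat (card T)"
    by (simp add: sum.cartesian_product[symmetric] sum_distrib_left mult.commute)
  also have "card T = fact (n - k)"
    unfolding T_def by (rule card_permutations) simp_all
  finally show ?thesis by simp
qed

text \<open>The left-hand side is the sum of \<open>1 - q\<^bsup>c\<^esup>\<close> over \<open>S\<^sub>n\<close>, where \<open>c\<close> is the number of cuts. Each
  summand is \<open>1 - q\<close> times a geometric sum, read as a sum over the cuts of \<open>\<pi>\<close>; exchanging the
  order of summation groups the permutations by their marked cut.\<close>

lemma fact_minus_sum_power_cuts:
  fixes q :: "'a::{comm_ring_1, semiring_char_0}"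
  shows "fact n - (\<Sum>\<pi>\<in>Sn n. q ^ card (cuts n \<pi>))
       = (1 - q) * (\<Sum>k\<in>{1..<n}. (\<Sum>\<sigma>\<in>Sn k. q ^ card (cuts k \<sigma>)) * fact (n - k))"
proof -
  have fin: "finite (Sn n)" unfolding Sn_def by (rule finite_permutations) simp
  have "card (Sn n) = fact n"
    unfolding Sn_def by (rule card_permutations) simp_all
  then have "fact n - (\<Sum>\<pi>\<in>Sn n. q ^ card (cuts n \<pi>)) = (\<Sum>\<pi>\<in>Sn n. 1 - q ^ card (cuts n \<pi>))"
    by (simp add: sum_subtractf)
  also have "\<dots> = (1 - q) * (\<Sum>\<pi>\<in>Sn n. \<Sum>k\<in>cuts n \<pi>. q ^ card {j \<in> cuts n \<pi>. j < k})"
    by (simp add: one_diff_power_eq sum_power_card_below sum_distrib_left)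
  also have "(\<Sum>\<pi>\<in>Sn n. \<Sum>k\<in>cuts n \<pi>. q ^ card {j \<in> cuts n \<pi>. j < k})
      = (\<Sum>\<pi>\<in>Sn n. \<Sum>k | k \<in> {1..<n} \<and> k \<in> cuts n \<pi>. q ^ card {j \<in> cuts n \<pi>. j < k})"
    by (intro sum.cong refl) (auto simp: cuts_def)
  also have "\<dots> = (\<Sum>k\<in>{1..<n}. \<Sum>\<pi> | \<pi> \<in> Sn n \<and> k \<in> cuts n \<pi>. q ^ card {j \<in> cuts n \<pi>. j < k})"
    by (rule sum.swap_restrict) (use fin in simp_all)
  also have "\<dots> = (\<Sum>k\<in>{1..<n}. (\<Sum>\<sigma>\<in>Sn k. q ^ card (cuts k \<sigma>)) * fact (n - k))"
    by (intro sum.cong refl sum_power_cuts_below_marked_cut)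
  finally show ?thesis .
qed

section \<open>Generating functions\<close>

lemma distribution_gf_cut_mesh_nth:
  "fps_nth (distribution_gf cut_mesh q) n = (\<Sum>\<pi>\<in>Sn n. q ^ card (cuts n \<pi>))"
  by (simp add: distribution_gf_def Sn_def mesh12_count_eq_card_cuts)

lemma distribution_gf_cut_mesh_nth_0: "fps_nth (distribution_gf cut_mesh q) 0 = 1"
  unfolding distribution_gf_cut_mesh_nth by (simp add: Sn_def cuts_def)

lemma distribution_gf_functional_equation:
  fixes q :: "'a::{comm_ring_1, semiring_char_0}"
  defines "D \<equiv> distribution_gf cut_mesh q"
  shows "perm_gf - D = fps_const (1 - q) * ((D - 1) * (perm_gf - 1))"
proof (rule fps_ext)
  fix n
  have "fps_nth ((D - 1) * (perm_gf - 1)) n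
      = (\<Sum>k=0..n. fps_nth (D - 1) k * fps_nth (perm_gf - 1) (n - k))"
    by (simp add: fps_mult_nth)
  \<comment> \<open>The constant terms of both factors vanish, which removes the terms \<open>k = 0\<close> and \<open>k = n\<close>.\<close>
  also have "\<dots> = (\<Sum>k\<in>{1..<n}. fps_nth (D - 1) k * fps_nth (perm_gf - 1) (n - k))"
    by (intro sum.mono_neutral_right)
      (auto simp: D_def distribution_gf_cut_mesh_nth_0 perm_gf_def not_le not_less)
  also have "\<dots> = (\<Sum>k\<in>{1..<n}. (\<Sum>\<sigma>\<in>Sn k. q ^ card (cuts k \<sigma>)) * fact (n - k))"
    by (intro sum.cong refl) (auto simp: D_def distribution_gf_cut_mesh_nth perm_gf_def)
  finally show "fps_nth (perm_gf - D) n
      = fps_nth (fps_const (1 - q) * ((D - 1) * (perm_gf - 1))) n"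
    using fact_minus_sum_power_cuts[of n q]
    by (simp add: D_def distribution_gf_cut_mesh_nth perm_gf_def)
qed

lemma distribution_gf_cut_mesh:
  fixes q :: "'a::{field, semiring_char_0}"
  shows "distribution_gf cut_mesh q
       = ((2 - fps_const q) * perm_gf + fps_const q - 1) /
         ((1 - fps_const q) * perm_gf + fps_const q)" (is "?D = ?N / ?M")
proof -
  have eq: "perm_gf - ?D = (1 - fps_const q) * ((?D - 1) * (perm_gf - 1))"
    using distribution_gf_functional_equation[of q] by (simp flip: fps_const_sub)
  have "?D * ?M - ?N = (1 - fps_const q) * ((?D - 1) * (perm_gf - 1)) - (perm_gf - ?D)"
    by (simp add: algebra_simps)
  then have "?D * ?M = ?N" using eq by simp
  \<comment> \<open>The constant term of the denominator is \<open>(1 - q) + q = 1\<close>.\<close>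
  moreover have "?M \<noteq> 0"
  proof
    assume "?M = 0"
    then have "fps_nth ?M 0 = 0" by simp
    then show False by (simp add: perm_gf_def)
  qed
  ultimately show ?thesis by (metis nonzero_mult_div_cancel_right)
qed

text \<open>Since \<open>0\<^sup>0 = 1\<close>, at \<open>q = 0\<close> exactly the avoiders keep weight \<open>1\<close>.\<close>

lemma avoidance_gf_eq_distribution_gf_0: "avoidance_gf R = distribution_gf R 0"
proof (rule fps_ext)
  fix n
  have "finite (Sn n)" unfolding Sn_def by (rule finite_permutations) simp
  then show "fps_nth (avoidance_gf R) n = fps_nth (distribution_gf R 0) n"
    by (simp add: avoidance_gf_def distribution_gf_def Sn_avoiding_def power_0_left
        sum.If_cases Collect_conj_eq)
qed

theorem theorem3p11:
  fixes R :: "(nat \<times> nat) set"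
  defines "R \<equiv> {(0,1), (0,2), (1,1), (1,2), (2,0)}"
  shows "(avoidance_gf R :: rat fps) = (2 * perm_gf - 1) / perm_gf
    \<and> distribution_gf R indet_q =
        ((2 - fps_const indet_q) * perm_gf + fps_const indet_q - 1) /
        ((1 - fps_const indet_q) * perm_gf + fps_const indet_q)"
proof
  show "(avoidance_gf R :: rat fps) = (2 * perm_gf - 1) / perm_gf"
    using distribution_gf_cut_mesh[of "0 :: rat"]
    unfolding R_def cut_mesh_def[symmetric] avoidance_gf_eq_distribution_gf_0 by simp
  show "distribution_gf R indet_q =
        ((2 - fps_const indet_q) * perm_gf + fps_const indet_q - 1) /
        ((1 - fps_const indet_q) * perm_gf + fps_const indet_q)"
    unfolding R_def cut_mesh_def[symmetric] by (rule distribution_gf_cut_mesh)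
qed

end
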